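(* Let $x_1,\dots,x_N\in\Omega$, and let $w_1,\dots,w_N>0$ satisfy $\sum_{i=1}^Nw_i=1$. Define $$G^\Delta_w(x_1,\dots,x_N):=\mathrm{Exp}_\Delta\left(\sum_{i=1}^Nw_i\,\mathrm{Log}_\Delta(x_i)\right).$$ Then $G^\Delta_w(x_1,\dots,x_N)$ is the unique minimizer on $\Omega$ of the weighted Fréchet functional $$F(z):=\sum_{i=1}^Nw_i\,d_\Delta^2(z,x_i).$$ Moreover, $$\det\bigl(G^\Delta_w(x_1,\dots,x_N)\bigr)=\prod_{i=1}^N\det(x_i)^{w_i}.$$
   Context: Let $V\subset \mathrm{Sym}(3,\mathbb{R})$ be the 5-dimensional space of real symmetric $3\times3$ matrices whose $(1,2)$ and $(2,1)$ entries are $0$, and let $\Omega\subset V$ be the open cone of positive definite matrices in $V$. Each $x\in\Omega$ has a unique lower triangular Cholesky factor $T_x$ with positive diagonal and $x=T_xT_x^{\top}$. For $v\in V$ let $\underline{v}$ be the unique lower triangular matrix with $v=\underline v+\underline v^{\top}$. The clan product on $V$ is $u\Delta w=\underline u\,w+w\,\underline u^{\top}$, $L_u(w)=u\Delta w$, and $Q_\Delta(u,v)=\mathrm{tr}(L_{u\Delta v})$, an inner product on $V$. The clan exponential $\mathrm{Exp}_\Delta:V\to\Omega$, $\mathrm{Exp}_\Delta(v)=\exp(\underline v)\exp(\underline v)^{\top}$, is a diffeomorphism with inverse $\mathrm{Log}_\Delta(x)=\log(T_x)+\log(T_x)^{\top}$ (principal logarithm). $d_\Delta$ is the Riemannian distance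 of the metric $g^\Delta_x(u,v)=Q_\Delta\bigl((d\mathrm{Log}_\Delta)_xu,(d\mathrm{Log}_\Delta)_xv\bigr)$ on $\Omega$; it satisfies $d_\Delta(x,y)=Q_\Delta(\xi,\xi)^{1/2}$ with $\xi=\mathrm{Log}_\Delta(x)-\mathrm{Log}_\Delta(y)$. *)

theory Defs
  imports "HOL-Analysis.Analysis"
begin

definition clanV :: "(real^3^3) set" where
  "clanV = {v. transpose v = v \<and> v $ 1 $ 2 = 0 \<and> v $ 2 $ 1 = 0}"

definition Omega :: "(real^3^3) set" where
  "Omega = {x \<in> clanV. \<forall>a. a \<noteq> 0 \<longrightarrow> 0 < a \<bullet> (x *v a)}"

text \<open>The strictly upper entries are listed explicitly: in the index type \<open>3\<close> the numeral
  \<open>3\<close> equals \<open>0\<close>, so the order of that type does not order the indices as 1, 2, 3.\<close>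

definition lower_triangular :: "real^3^3 \<Rightarrow> bool" where
  "lower_triangular L \<longleftrightarrow> L $ 1 $ 2 = 0 \<and> L $ 1 $ 3 = 0 \<and> L $ 2 $ 3 = 0"

definition cholesky :: "real^3^3 \<Rightarrow> real^3^3" where
  "cholesky x = (THE T. lower_triangular T \<and> (\<forall>i. 0 < T $ i $ i) \<and> x = T ** transpose T)"

definition lower_part :: "real^3^3 \<Rightarrow> real^3^3" where
  "lower_part v = (THE L. lower_triangular L \<and> v = L + transpose L)"

definition mat_exp :: "real^'n^'n \<Rightarrow> real^'n^'n" where
  "mat_exp A = (\<Sum>k. (1 / fact k) *\<^sub>R (((**) A ^^ k) (mat 1)))"

definition complex_eigenvalue :: "real^'n^'n \<Rightarrow> complex \<Rightarrow> bool" where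
  "complex_eigenvalue A c \<longleftrightarrow>
     (\<exists>a :: complex^'n. a \<noteq> 0 \<and> map_matrix complex_of_real A *v a = c *s a)"

text \<open>For a real matrix without eigenvalues in the closed negative real axis, the principal
  logarithm is the unique logarithm with all eigenvalues in the open strip of imaginary part
  between \<open>- pi\<close> and \<open>pi\<close>; it is a real matrix.\<close>

definition mat_log :: "real^'n^'n \<Rightarrow> real^'n^'n" where
  "mat_log A = (THE X. mat_exp X = A \<and> (\<forall>c. complex_eigenvalue X c \<longrightarrow> \<bar>Im c\<bar> < pi))"

definition clan_prod :: "real^3^3 \<Rightarrow> real^3^3 \<Rightarrow> real^3^3" where
  "clan_prod u w = lower_part u ** w + w ** transpose (lower_part u)"

text \<open>Trace of an endomorphism \<open>f\<close> of a finite-dimensional subspace \<open>S\<close>; the value does not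
  depend on the chosen basis.\<close>

definition trace_on :: "'a::real_vector set \<Rightarrow> ('a \<Rightarrow> 'a) \<Rightarrow> real" where
  "trace_on S f =
     (let B = (SOME B. independent B \<and> span B = S) in \<Sum>b\<in>B. representation B (f b) b)"

definition Q_clan :: "real^3^3 \<Rightarrow> real^3^3 \<Rightarrow> real" where
  "Q_clan u v = trace_on clanV (clan_prod (clan_prod u v))"

definition Exp_clan :: "real^3^3 \<Rightarrow> real^3^3" where
  "Exp_clan v = mat_exp (lower_part v) ** transpose (mat_exp (lower_part v))"

definition Log_clan :: "real^3^3 \<Rightarrow> real^3^3" where
  "Log_clan x = mat_log (cholesky x) + transpose (mat_log (cholesky x))"

text \<open>\<open>Omega\<close> is open in \<open>clanV\<close> but not in the space of all matrices, so the derivative is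
  taken within \<open>Omega\<close>; it is determined on the tangent space \<open>clanV\<close>.\<close>

definition clan_metric :: "real^3^3 \<Rightarrow> real^3^3 \<Rightarrow> real^3^3 \<Rightarrow> real" where
  "clan_metric x u v =
     (let D = frechet_derivative Log_clan (at x within Omega) in Q_clan (D u) (D v))"

definition clan_speed :: "(real \<Rightarrow> real^3^3) \<Rightarrow> real \<Rightarrow> real" where
  "clan_speed \<gamma> t =
     (let \<gamma>' = vector_derivative \<gamma> (at t) in sqrt (clan_metric (\<gamma> t) \<gamma>' \<gamma>'))"

text \<open>A \<open>valid_path\<close> may have an unbounded derivative near its finitely many exceptional
  points and hence infinite length.  The integral of a non-integrable function is \<open>0\<close>, so
  integrability of the speed (finite length) must be required; it is automatic for
  classical piecewise continuously differentiable curves.\<close>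

definition clan_dist :: "real^3^3 \<Rightarrow> real^3^3 \<Rightarrow> real" where
  "clan_dist x y = Inf {integral {0..1} (clan_speed \<gamma>) | \<gamma>.
     valid_path \<gamma> \<and> path_image \<gamma> \<subseteq> Omega \<and> pathstart \<gamma> = x \<and> pathfinish \<gamma> = y \<and>
     clan_speed \<gamma> integrable_on {0..1}}"

definition clan_mean :: "nat \<Rightarrow> (nat \<Rightarrow> real) \<Rightarrow> (nat \<Rightarrow> real^3^3) \<Rightarrow> real^3^3" where
  "clan_mean N w x = Exp_clan (\<Sum>i=1..N. w i *\<^sub>R Log_clan (x i))"

definition frechet_functional ::
    "nat \<Rightarrow> (nat \<Rightarrow> real) \<Rightarrow> (nat \<Rightarrow> real^3^3) \<Rightarrow> real^3^3 \<Rightarrow> real" where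
  "frechet_functional N w x z = (\<Sum>i=1..N. w i * (clan_dist z (x i))\<^sup>2)"

end

theory Submission
  imports Defs "HOL-Computational_Algebra.Fundamental_Theorem_Algebra"
begin

text \<open>In the coordinates given by \<^const>\<open>Log_clan\<close> the metric is the constant inner product
  \<^const>\<open>Q_clan\<close>: a curve in \<^const>\<open>Omega\<close> is exactly as long as its logarithm, and the preimages of
  straight segments are shortest.  Hence the distance is Euclidean in these coordinates, and the
  weighted sum of squared distances to points equals the squared distance to their weighted mean
  plus a constant.  The determinant of \<open>Exp_clan v\<close> is the exponential of the trace of \<open>v\<close>, which is
  linear in \<open>v\<close>.

  The principal logarithm is accessible because \<open>exp X - e^y = (X - y) h(X)\<close>, where \<open>h(X)\<close> is
  injective for real \<open>y\<close> if the eigenvalues of \<open>X\<close> have imaginary parts in \<open>(- pi, pi)\<close>.  Applied to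
  the unit vectors, this determines \<open>X\<close> from \<open>exp X\<close> when the latter is lower triangular.\<close>

section \<open>Matrix exponential and principal logarithm\<close>

text \<open>\<open>pow_diff f y k\<close> is the sum of \<open>y^(k - 1 - i) f^i\<close> over \<open>i < k\<close>, that is,
  \<open>(f^k - y^k) / (f - y)\<close>.\<close>

primrec pow_diff :: "('a::real_vector \<Rightarrow> 'a) \<Rightarrow> real \<Rightarrow> nat \<Rightarrow> 'a \<Rightarrow> 'a" where
  "pow_diff f y 0 u = 0"
| "pow_diff f y (Suc k) u = y *\<^sub>R pow_diff f y k u + (f ^^ k) u"

text \<open>Intertwining passes to powers and to their combinations. Below, \<open>g\<close> is
  multiplication by a scalar, the embedding of a line spanned by an eigenvector, or a map between
  the spaces of \<open>exp_ker_intertwine\<close>.\<close>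

lemma pow_diff_intertwine:
  assumes "linear g" and comm: "\<And>u. g (f u) = f' (g u)"
  shows "g (pow_diff f y k u) = pow_diff f' y k (g u)"
proof (induction k)
  case 0
  show ?case using assms(1) by (simp add: linear_0)
next
  case (Suc k)
  have "g ((f ^^ k) u) = (f' ^^ k) (g u)" by (induction k) (simp_all add: comm)
  then show ?case using Suc assms(1) by (simp add: linear_add linear_scale)
qed

lemma linear_funpow: "linear f \<Longrightarrow> linear (f ^^ k)"
  for f :: "'a::real_vector \<Rightarrow> 'a"
proof (induction k)
  case (Suc k)
  from linear_compose[OF this(1)[OF Suc.prems] Suc.prems] show ?case by (simp add: o_def)
qed (simp add: linear_ident id_def)

lemma linear_pow_diff:
  assumes "linear f"
  shows "linear (pow_diff f y k)"
proof (induction k)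
  case 0
  show ?case using linear_zero by simp
next
  case (Suc k)
  from linear_compose_add[OF linear_compose_scale_right[OF this] linear_funpow[OF assms]]
  show ?case by simp
qed

lemma pow_diff_telescope:
  assumes "linear f"
  shows "pow_diff f y k (f u - y *\<^sub>R u) = (f ^^ k) u - y ^ k *\<^sub>R u"
proof (induction k)
  case (Suc k)
  show ?case using linear_funpow[OF assms, of k]
    by (simp add: Suc linear_diff linear_scale funpow_swap1 algebra_simps)
qed simp

lemma funpow_mult_one: "(((*) s) ^^ k) 1 = s ^ k" for s :: "'a::monoid_mult"
  by (induction k) simp_all

text \<open>The first divided difference of \<open>exp\<close>, continued by the derivative on the
  diagonal. It is the factor by which \<open>mat_exp\<close> multiplies the off-diagonal entries of
  the triangular matrices below.\<close>

definition exp_dd :: "'a::{real_normed_field,banach} \<Rightarrow> 'a \<Rightarrow> 'a" where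
  "exp_dd s t = (if s = t then exp s else (exp s - exp t) / (s - t))"

text \<open>For multiplication by \<open>s\<close>, \<open>pow_diff\<close> at \<open>1\<close> is
  the divided difference of the \<open>k\<close>-th power: \<open>k s^(k - 1)\<close> if
  \<open>s = y\<close>, and \<open>(s^k - y^k) / (s - y)\<close> otherwise.\<close>

lemma exp_dd_sums:
  fixes s :: "'a::{real_normed_field,banach}"
  shows "(\<lambda>k. (1 / fact k) *\<^sub>R pow_diff ((*) s) y k 1) sums exp_dd s (of_real y)"
proof (cases "s = of_real y")
  case True
  have p: "pow_diff ((*) s) y k 1 = of_nat k * s ^ (k - 1)" for k
  proof (induction k)
    case (Suc k)
    have "pow_diff ((*) s) y (Suc k) 1 = s * pow_diff ((*) s) y k 1 + s ^ k"
      by (simp add: funpow_mult_one scaleR_conv_of_real True)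
    moreover have "s * (of_nat k * s ^ (k - 1)) + s ^ k = of_nat (Suc k) * s ^ k"
      by (cases k) (simp_all add: algebra_simps)
    ultimately show ?case unfolding Suc by simp
  qed simp
  \<comment> \<open>The term of index 0 vanishes; cancelling \<open>k + 1\<close> in the others
    leaves the exponential series shifted by one.\<close>
  have "(\<lambda>k. (1 / fact (Suc k)) *\<^sub>R pow_diff ((*) s) y (Suc k) 1) = (\<lambda>k. s ^ k /\<^sub>R fact k)"
    unfolding p by (rule ext) (simp add: scaleR_conv_of_real divide_simps del: of_nat_Suc)
  then have "(\<lambda>k. (1 / fact (Suc k)) *\<^sub>R pow_diff ((*) s) y (Suc k) 1) sums exp s"
    using exp_converges[of s] by simp
  then show ?thesis
    by (subst (asm) sums_Suc_iff) (simp add: True exp_dd_def)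
next
  case False
  have p: "pow_diff ((*) s) y k 1 = (s ^ k - of_real y ^ k) / (s - of_real y)" for k
  proof -
    \<comment> \<open>The factor \<open>s - y\<close> commutes with multiplication by
      \<open>s\<close>, so it can be pulled out of \<open>pow_diff\<close>; telescoping then permits
      the division.\<close>
    have "pow_diff ((*) s) y k (1 * (s - of_real y)) = pow_diff ((*) s) y k 1 * (s - of_real y)"
      by (rule pow_diff_intertwine[symmetric]) (auto intro!: linearI simp: algebra_simps)
    moreover have "linear ((*) s)" by (auto intro!: linearI simp: algebra_simps)
    ultimately show ?thesis
      using pow_diff_telescope[of "(*) s" y k 1] False
      by (simp add: funpow_mult_one scaleR_conv_of_real divide_simps)
  qed
  have "(\<lambda>k. (s ^ k /\<^sub>R fact k - of_real y ^ k /\<^sub>R fact k) / (s - of_real y)) sums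
      ((exp s - exp (of_real y)) / (s - of_real y))"
    by (intro sums_divide sums_diff exp_converges)
  then show ?thesis using False
    by (simp add: p exp_dd_def scaleR_diff_right left_diff_distrib divide_inverse)
qed

text \<open>The kernel of \<open>(exp f - e^y) / (f - y)\<close>, written as a power series so that it makes sense
  for every \<open>f\<close>.\<close>

definition exp_ker :: "('a::real_normed_vector \<Rightarrow> 'a) \<Rightarrow> real \<Rightarrow> 'a set" where
  "exp_ker f y = {u. (\<lambda>k. (1 / fact k) *\<^sub>R pow_diff f y k u) sums 0}"

text \<open>Continuity lets \<open>g\<close> pass through the series. This gives invariance of the
  kernel under \<open>A - \<mu>\<close> and the passage from real to complex matrices.\<close>

lemma exp_ker_intertwine:
  assumes "bounded_linear g" and "\<And>u. g (f u) = f' (g u)" and "u \<in> exp_ker f y"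
  shows "g u \<in> exp_ker f' y"
proof -
  interpret g: bounded_linear g by fact
  have "g (pow_diff f y k u) = pow_diff f' y k (g u)" for k
    by (rule pow_diff_intertwine[where g = g and f = f and f' = f', OF g.linear_axioms assms(2)])
  moreover from assms(3) have "(\<lambda>k. (1 / fact k) *\<^sub>R pow_diff f y k u) sums 0" by (simp add: exp_ker_def)
  note g.sums[OF this]
  ultimately show ?thesis
    by (simp add: exp_ker_def g.scaleR g.zero)
qed

lemma bounded_linear_euclideanI:
  fixes g :: "'a::euclidean_space \<Rightarrow> 'b::real_normed_vector"
  assumes "\<And>u v. g (u + v) = g u + g v" "\<And>r u. g (r *\<^sub>R u) = r *\<^sub>R g u"
  shows "bounded_linear g"
  using assms by (simp add: linear_conv_bounded_linear[symmetric] linearI)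

text \<open>On an eigenvector the series acts as the scalar \<open>exp_dd \<mu> y\<close>. It is
  nonzero, because \<open>exp\<close> takes the value \<open>e^y\<close> in the strip
  \<open>\<bar>Im \<mu>\<bar> < pi\<close> only at \<open>y\<close> itself.\<close>

lemma eigenvector_notin_exp_ker:
  fixes A :: "complex^'n^'n"
  assumes Av: "A *v v = \<mu> *s v" and \<mu>: "\<bar>Im \<mu>\<bar> < pi" and v: "v \<in> exp_ker ((*v) A) y"
  shows "v = 0"
proof -
  have eq: "pow_diff ((*v) A) y k v = pow_diff ((*) \<mu>) y k 1 *s v" for k
  proof -
    have "(\<lambda>z. z *s v) (pow_diff ((*) \<mu>) y k 1) = pow_diff ((*v) A) y k ((\<lambda>z. z *s v) 1)"
      by (rule pow_diff_intertwine)
        (auto intro!: linearI simp: vec_eq_iff algebra_simps Av vec.scale)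
    then show ?thesis by simp
  qed
  have "exp_dd \<mu> (of_real y) * v $ i = 0" for i
  proof -
    have "(\<lambda>k. ((1 / fact k) *\<^sub>R pow_diff ((*v) A) y k v) $ i) sums (0 $ i)"
      using v by (intro bounded_linear.sums[OF bounded_linear_vec_nth]) (simp add: exp_ker_def)
    moreover have "(\<lambda>k. ((1 / fact k) *\<^sub>R pow_diff ((*v) A) y k v) $ i) sums (exp_dd \<mu> (of_real y) * v $ i)"
      using sums_mult2[OF exp_dd_sums[of \<mu> y], of "v $ i"] by (simp add: eq)
    ultimately show ?thesis using sums_unique2 by fastforce
  qed
  moreover have "exp_dd \<mu> (of_real y) \<noteq> 0"
  proof (cases "\<mu> = of_real y")
    case False
    have "exp \<mu> \<noteq> exp (of_real y)"
    proof
      assume "exp \<mu> = exp (of_real y)"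
      then obtain n :: int where n: "\<mu> = of_real y + (of_int (2 * n) * pi) * \<i>"
        unfolding exp_eq by blast
      then have "Im \<mu> = 2 * real_of_int n * pi" by simp
      with \<mu> have "\<bar>real_of_int n\<bar> * 2 < 1" by (simp add: abs_mult)
      then have "n = 0" by linarith
      with n False show False by simp
    qed
    then show ?thesis using False by (simp add: exp_dd_def)
  qed (simp add: exp_dd_def)
  ultimately show ?thesis by (simp add: vec_eq_iff)
qed

text \<open>Vieta's formulas for \<open>X^3 - p X^2 + q X - r\<close>, which splits by the
  fundamental theorem of algebra.\<close>

lemma cubic_roots:
  fixes p q r :: complex
  obtains a b c where "p = a + b + c" "q = a * b + b * c + c * a" "r = a * b * c"
proof -
  obtain \<rho> where \<rho>: "smult (lead_coeff [:- r, q, - p, 1:]) (\<Prod>i<degree [:- r, q, - p, 1:]. [:- \<rho> i, 1:]) = [:- r, q, - p, 1:]"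
    by (rule complex_poly_decompose')
  have "p = \<rho> 0 + \<rho> 1 + \<rho> 2" "q = \<rho> 0 * \<rho> 1 + \<rho> 1 * \<rho> 2 + \<rho> 2 * \<rho> 0" "r = \<rho> 0 * \<rho> 1 * \<rho> 2"
    using \<rho> by (simp_all add: eval_nat_numeral algebra_simps)
  then show ?thesis by (rule that)
qed

text \<open>The roots come from the characteristic polynomial, by the Cayley-Hamilton theorem.\<close>

lemma product_of_shifts_zero:
  fixes A :: "complex^3^3"
  obtains a b c where "\<And>v. A *v (A *v (A *v v - c *s v) - b *s (A *v v - c *s v))
    - a *s (A *v (A *v v - c *s v) - b *s (A *v v - c *s v)) = 0"
proof -
  \<comment> \<open>The coefficients of the characteristic polynomial: trace, sum of the principal 2
    by 2 minors, determinant.\<close>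
  obtain a b c where abc: "A$1$1 + A$2$2 + A$3$3 = a + b + c"
    "A$1$1 * A$2$2 - A$1$2 * A$2$1 + (A$1$1 * A$3$3 - A$1$3 * A$3$1) + (A$2$2 * A$3$3 - A$2$3 * A$3$2)
      = a * b + b * c + c * a"
    "det A = a * b * c"
    by (rule cubic_roots)
  show ?thesis
  proof
    fix v
    let ?p = "a + b + c" and ?q = "a * b + b * c + c * a" and ?r = "a * b * c"
    have "A *v (A *v (A *v v - c *s v) - b *s (A *v v - c *s v))
        - a *s (A *v (A *v v - c *s v) - b *s (A *v v - c *s v)) =
      A *v (A *v (A *v v)) - ?p *s (A *v (A *v v)) + ?q *s (A *v v) - ?r *s v"
      by (simp add: vec.diff vec.scale vec_eq_iff forall_3 matrix_vector_mult_def sum_3 algebra_simps)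
    also have "\<dots> = 0"
      unfolding abc[symmetric] det_3
      by (simp add: vec_eq_iff forall_3 matrix_vector_mult_def sum_3 algebra_simps)
    finally show "A *v (A *v (A *v v - c *s v) - b *s (A *v v - c *s v))
        - a *s (A *v (A *v v - c *s v) - b *s (A *v v - c *s v)) = 0" .
  qed
qed

lemma bounded_linear_mult_vec_complex: "bounded_linear (\<lambda>v. (A::complex^'n^'m) *v v)"
  by (rule bounded_linear_euclideanI)
    (simp_all add: vec_eq_iff matrix_vector_mult_def algebra_simps sum.distrib scaleR_sum_right)

text \<open>The kernel is invariant under each shift \<open>A - \<mu>\<close>, and three shifts
  annihilate everything. Undoing them one at a time, each vector is killed by the next shift and
  lies in the kernel, so it is zero. Diagonalizability is thus avoided.\<close>

lemma exp_ker_complex_trivial: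
  fixes A :: "complex^3^3"
  assumes eig: "\<And>\<mu> v. A *v v = \<mu> *s v \<Longrightarrow> v \<noteq> 0 \<Longrightarrow> \<bar>Im \<mu>\<bar> < pi"
    and v: "v \<in> exp_ker ((*v) A) y"
  shows "v = 0"
proof -
  obtain a b c where zero: "\<And>v. A *v (A *v (A *v v - c *s v) - b *s (A *v v - c *s v))
    - a *s (A *v (A *v v - c *s v) - b *s (A *v v - c *s v)) = 0"
    using product_of_shifts_zero[of A thesis] by blast
  have no_eig: "v = 0" if "A *v v - \<mu> *s v = 0" "v \<in> exp_ker ((*v) A) y" for \<mu> v
    using that eig[of v \<mu>] eigenvector_notin_exp_ker[of A v \<mu> y] by auto
  have inv: "A *v v - \<mu> *s v \<in> exp_ker ((*v) A) y" if "v \<in> exp_ker ((*v) A) y" for \<mu> v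
  proof -
    have "bounded_linear (\<lambda>v. A *v v - \<mu> *s v)"
      by (intro bounded_linear_sub bounded_linear_mult_vec_complex bounded_linear_euclideanI)
        (simp_all add: vec_eq_iff algebra_simps)
    from exp_ker_intertwine[OF this, where f = "(*v) A" and f' = "(*v) A", OF _ that]
    show ?thesis by (simp add: vec.diff vec.scale)
  qed
  show ?thesis
    using no_eig inv zero v by meson
qed

text \<open>The coordinatewise inclusion of \<open>real^3\<close> into \<open>complex^3\<close>
  intertwines \<open>X\<close> with its complexification.\<close>

lemma exp_ker_real_trivial:
  fixes X :: "real^3^3"
  assumes eig: "\<And>\<mu>. complex_eigenvalue X \<mu> \<Longrightarrow> \<bar>Im \<mu>\<bar> < pi"
    and u: "u \<in> exp_ker ((*v) X) y"
  shows "u = 0"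
proof -
  let ?c = "\<lambda>u::real^3. \<chi> i. complex_of_real (u $ i)"
  have "bounded_linear ?c"
    by (rule bounded_linear_euclideanI) (simp_all add: vec_eq_iff scaleR_conv_of_real[where 'a = complex])
  then have "?c u \<in> exp_ker ((*v) (map_matrix complex_of_real X)) y"
    by (rule exp_ker_intertwine[OF _ _ u])
      (simp add: vec_eq_iff matrix_vector_mult_def map_matrix_def)
  then have "?c u = 0"
    by (rule exp_ker_complex_trivial[rotated]) (use eig in \<open>auto simp: complex_eigenvalue_def\<close>)
  then show ?thesis by (simp add: vec_eq_iff)
qed

section \<open>Exponential and logarithm of lower triangular matrices\<close>

lemma matrix_power_vec: "(((**) A ^^ k) (mat 1)) *v v = ((*v) A ^^ k) v" for A :: "real^'n^'n"
  by (induction k) (simp_all flip: matrix_vector_mul_assoc)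

text \<open>The powers are bounded by a multiple of \<open>K^k\<close>, with \<open>K\<close> a
  bound for left multiplication by \<open>A\<close>; compare with the series of
  \<open>exp K\<close>.\<close>

lemma mat_exp_sums:
  fixes A :: "real^'n^'n"
  shows "(\<lambda>k. (1 / fact k) *\<^sub>R (((**) A ^^ k) (mat 1))) sums mat_exp A"
proof -
  have "bounded_linear ((**) A)"
    by (rule bounded_linear_euclideanI)
      (simp_all add: matrix_add_ldistrib vec_eq_iff matrix_matrix_mult_def sum_distrib_left sum.distrib algebra_simps)
  then obtain K where K: "\<And>B::real^'n^'n. norm (A ** B) \<le> norm B * K" "K \<ge> 0"
    using bounded_linear.nonneg_bounded by blast
  have bound: "norm (((**) A ^^ k) (mat 1)) \<le> norm (mat 1 :: real^'n^'n) * K ^ k" for k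
  proof (induction k)
    case (Suc k)
    have "norm (((**) A ^^ Suc k) (mat 1)) \<le> norm (((**) A ^^ k) (mat 1)) * K"
      using K(1)[of "((**) A ^^ k) (mat 1)"] by simp
    also have "\<dots> \<le> norm (mat 1 :: real^'n^'n) * K ^ k * K"
      using Suc K(2) by (rule mult_right_mono)
    finally show ?case by (simp add: algebra_simps)
  qed simp
  have "summable (\<lambda>k. norm (mat 1 :: real^'n^'n) * (K ^ k /\<^sub>R fact k))"
    by (intro summable_mult summable_exp_generic)
  then have "summable (\<lambda>k. (1 / fact k) *\<^sub>R (((**) A ^^ k) (mat 1)))"
    by (rule summable_comparison_test'[where N = 0]) (use bound in \<open>simp add: divide_simps mult.commute\<close>)
  then show ?thesis by (simp add: mat_exp_def summable_sums)
qed

lemma mat_exp_vec_sums: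
  fixes A :: "real^'n^'n"
  shows "(\<lambda>k. (1 / fact k) *\<^sub>R ((*v) A ^^ k) v) sums (mat_exp A *v v)"
proof -
  have "bounded_linear (\<lambda>B::real^'n^'n. B *v v)"
    by (rule bounded_linear_euclideanI)
      (simp_all add: vec_eq_iff matrix_vector_mult_def algebra_simps sum.distrib sum_distrib_left)
  from bounded_linear.sums[OF this mat_exp_sums[of A]] show ?thesis
    by (simp add: matrix_power_vec scaleR_matrix_vector_assoc[symmetric])
qed

text \<open>The lower parts of elements of \<open>clanV\<close>: first the diagonal, then the rest
  of the last row. Since the (2,1) entry is 0, they are closed under products, and each off-diagonal
  entry of a power involves only two diagonal entries.\<close>

definition ltri :: "real \<Rightarrow> real \<Rightarrow> real \<Rightarrow> real \<Rightarrow> real \<Rightarrow> real^3^3" where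
  "ltri a b c d e = vector [vector [a, 0, 0], vector [0, b, 0], vector [d, e, c]]"

lemma ltri_nth [simp]:
  "ltri a b c d e $ 1 $ 1 = a" "ltri a b c d e $ 1 $ 2 = 0" "ltri a b c d e $ 1 $ 3 = 0"
  "ltri a b c d e $ 2 $ 1 = 0" "ltri a b c d e $ 2 $ 2 = b" "ltri a b c d e $ 2 $ 3 = 0"
  "ltri a b c d e $ 3 $ 1 = d" "ltri a b c d e $ 3 $ 2 = e" "ltri a b c d e $ 3 $ 3 = c"
  by (simp_all add: ltri_def)

lemma mat3_eq_iff:
  "A = B \<longleftrightarrow> A$1$1 = B$1$1 \<and> A$1$2 = B$1$2 \<and> A$1$3 = B$1$3 \<and> A$2$1 = B$2$1 \<and> A$2$2 = B$2$2 \<and>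
    A$2$3 = B$2$3 \<and> A$3$1 = B$3$1 \<and> A$3$2 = B$3$2 \<and> A$3$3 = B$3$3" for A B :: "'a^3^3"
  by (simp add: vec_eq_iff forall_3)

text \<open>The (3,1) entry of the \<open>k\<close>-th power is \<open>d\<close> times the sum of
  \<open>a^i c^(k - 1 - i)\<close>, which is a \<open>pow_diff\<close>; likewise for (3,2).\<close>

lemma mat_exp_ltri:
  "mat_exp (ltri a b c d e) = ltri (exp a) (exp b) (exp c) (d * exp_dd a c) (e * exp_dd b c)"
proof -
  let ?A = "ltri a b c d e"
  have P: "((**) ?A ^^ k) (mat 1) = ltri (a ^ k) (b ^ k) (c ^ k)
      (d * pow_diff ((*) a) c k 1) (e * pow_diff ((*) b) c k 1)" for k
    by (induction k) (simp_all add: mat3_eq_iff mat_def matrix_matrix_mult_def sum_3 funpow_mult_one distrib_left mult.left_commute)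
  have s: "(\<lambda>k. ((1 / fact k) *\<^sub>R ((**) ?A ^^ k) (mat 1)) $ i $ j) sums (mat_exp ?A $ i $ j)" for i j
    by (intro bounded_linear.sums[OF bounded_linear_vec_nth] mat_exp_sums)
  have e: "(\<lambda>k. s ^ k / fact k) sums exp s" for s :: real
    using exp_converges[of s] by (simp add: field_simps)
  have dd: "(\<lambda>k. t * pow_diff ((*) s) y k 1 / fact k) sums (t * exp_dd s y)" for s t y :: real
    using sums_mult[OF exp_dd_sums[of s y], of t] by (simp add: field_simps)
  show ?thesis
    unfolding mat3_eq_iff
    using s[of 1 1] s[of 1 2] s[of 1 3] s[of 2 1] s[of 2 2] s[of 2 3] s[of 3 1] s[of 3 2] s[of 3 3]
    unfolding P by (auto intro: sums_unique2 e dd sums_zero)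
qed

lemma complex_eigenvalue_ltri:
  assumes "complex_eigenvalue (ltri a b c d e) \<mu>"
  shows "Im \<mu> = 0"
proof -
  obtain v :: "complex^3" where "v \<noteq> 0" and
    "of_real a * v$1 = \<mu> * v$1" "of_real b * v$2 = \<mu> * v$2"
    "of_real d * v$1 + of_real e * v$2 + of_real c * v$3 = \<mu> * v$3"
    using assms
    by (auto simp: complex_eigenvalue_def vec_eq_iff forall_3 matrix_vector_mult_def sum_3 map_matrix_def)
  then have "\<mu> = of_real a \<or> \<mu> = of_real b \<or> \<mu> = of_real c"
    by (auto simp: vec_eq_iff forall_3)
  then show ?thesis by auto
qed

lemma exp_dd_commute: "exp_dd s t = exp_dd t s"
  by (metis exp_dd_def minus_diff_eq minus_divide_divide)

lemma exp_dd_pos: "exp_dd s t > 0" for s t :: real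
  by (simp add: exp_dd_def divide_simps)

text \<open>The eigenvalues of \<open>ltri a b c d e\<close> are real, so it is a candidate. A
  competitor \<open>X\<close> need not be triangular; its columns are recovered from those of
  \<open>exp X\<close>, the third one first.\<close>

lemma mat_log_mat_exp_ltri: "mat_log (mat_exp (ltri a b c d e)) = ltri a b c d e"
  unfolding mat_log_def
proof (rule the_equality, intro conjI allI impI)
  show "\<bar>Im \<mu>\<bar> < pi" if "complex_eigenvalue (ltri a b c d e) \<mu>" for \<mu>
    using complex_eigenvalue_ltri[OF that] by simp
next
  fix X :: "real^3^3"
  assume X: "mat_exp X = mat_exp (ltri a b c d e) \<and> (\<forall>\<mu>. complex_eigenvalue X \<mu> \<longrightarrow> \<bar>Im \<mu>\<bar> < pi)"
  let ?T = "mat_exp (ltri a b c d e)"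
  have lin: "linear ((*v) X)" by (rule matrix_vector_mul_linear)
  \<comment> \<open>With \<open>h(X)\<close> the series of the \<open>pow_diff\<close>, this reads
    \<open>h(X) (X - y) u = (exp X - e^y) u\<close>; each term telescopes.\<close>
  have shift: "(\<lambda>k. (1 / fact k) *\<^sub>R pow_diff ((*v) X) y k (X *v u - y *\<^sub>R u)) sums (?T *v u - exp y *\<^sub>R u)"
    for u y
  proof -
    have "(\<lambda>k. (y ^ k /\<^sub>R fact k) *\<^sub>R u) sums (exp y *\<^sub>R u)"
      by (intro bounded_linear.sums[OF bounded_linear_scaleR_left] exp_converges)
    from sums_diff[OF mat_exp_vec_sums[of X u] this] show ?thesis using X
      by (simp add: pow_diff_telescope[OF lin] scaleR_diff_right divide_inverse mult.commute)
  qed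
  have triv: "u = 0" if "(\<lambda>k. (1 / fact k) *\<^sub>R pow_diff ((*v) X) y k u) sums 0" for u y
    using exp_ker_real_trivial[of X u y] X that by (simp add: exp_ker_def)
  have T: "?T *v u = vector [exp a * u$1, exp b * u$2, d * exp_dd a c * u$1 + e * exp_dd b c * u$2 + exp c * u$3]"
    for u by (simp add: mat_exp_ltri vec_eq_iff forall_3 matrix_vector_mult_def sum_3)
  have [simp]: "(1::3) \<noteq> 2" "(1::3) \<noteq> 3" "(2::3) \<noteq> 3" "(2::3) \<noteq> 1" "(3::3) \<noteq> 1" "(3::3) \<noteq> 2" by simp_all
  let ?e = "\<lambda>i. axis i 1 :: real^3"
  have 3: "X *v ?e 3 = c *\<^sub>R ?e 3"
  proof -
    have "?T *v ?e 3 - exp c *\<^sub>R ?e 3 = 0" by (simp add: T vec_eq_iff forall_3 axis_def)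
    with shift[of c "?e 3"] show ?thesis using triv[of c "X *v ?e 3 - c *\<^sub>R ?e 3"] by simp
  qed
  \<comment> \<open>On the eigenvector \<open>?e 3\<close> of \<open>X\<close>, \<open>h(X)\<close>
    is the scalar \<open>exp_dd c s\<close>. Hence \<open>(X - s) e_i\<close> and
    \<open>t e_3\<close> have the same image under the injective map \<open>h(X)\<close>.\<close>
  have col: "X *v ?e i = s *\<^sub>R ?e i + t *\<^sub>R ?e 3"
    if *: "?T *v ?e i = exp s *\<^sub>R ?e i + (t * exp_dd s c) *\<^sub>R ?e 3" for i s t
  proof -
    have p3: "pow_diff ((*v) X) s k (?e 3) = pow_diff ((*) c) s k 1 *\<^sub>R ?e 3" for k
      using pow_diff_intertwine[of "\<lambda>z. z *\<^sub>R ?e 3" "(*) c" "(*v) X" s k 1]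
      by (simp add: linear_scale_left matrix_vector_mult_scaleR 3 linearI scaleR_add_left)
    have "(\<lambda>k. ((1 / fact k) *\<^sub>R pow_diff ((*) c) s k 1) *\<^sub>R (t *\<^sub>R ?e 3)) sums (exp_dd c s *\<^sub>R (t *\<^sub>R ?e 3))"
      using exp_dd_sums[of c s] by (intro bounded_linear.sums[OF bounded_linear_scaleR_left]) simp
    moreover have "?T *v ?e i - exp s *\<^sub>R ?e i = exp_dd c s *\<^sub>R (t *\<^sub>R ?e 3)"
      using * by (simp add: exp_dd_commute[of c] mult.commute)
    ultimately have "(\<lambda>k. (1 / fact k) *\<^sub>R (pow_diff ((*v) X) s k (X *v ?e i - s *\<^sub>R ?e i) - t *\<^sub>R pow_diff ((*v) X) s k (?e 3))) sums 0"
      using sums_diff[OF shift[of s "?e i"], of _ "exp_dd c s *\<^sub>R (t *\<^sub>R ?e 3)"]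
      by (simp add: p3 scaleR_diff_right mult.commute mult.left_commute)
    moreover have "linear (pow_diff ((*v) X) s k)" for k
      by (rule linear_pow_diff[OF lin])
    ultimately have "X *v ?e i - s *\<^sub>R ?e i - t *\<^sub>R ?e 3 = 0"
      by (intro triv[of s]) (simp add: linear_diff linear_scale)
    then show ?thesis by (simp add: algebra_simps)
  qed
  have 1: "X *v ?e 1 = a *\<^sub>R ?e 1 + d *\<^sub>R ?e 3"
    by (rule col) (simp add: T vec_eq_iff forall_3 axis_def)
  have 2: "X *v ?e 2 = b *\<^sub>R ?e 2 + e *\<^sub>R ?e 3"
    by (rule col) (simp add: T vec_eq_iff forall_3 axis_def)
  have entry: "X $ i $ j = (X *v ?e j) $ i" for i j
    by (simp add: matrix_vector_mult_basis column_def)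
  show "X = ltri a b c d e"
    unfolding mat3_eq_iff entry 1 2 3 by (simp add: axis_def)
qed simp

section \<open>The clan structure in coordinates\<close>

definition csym :: "real \<Rightarrow> real \<Rightarrow> real \<Rightarrow> real \<Rightarrow> real \<Rightarrow> real^3^3" where
  "csym a b c d e = vector [vector [a, 0, d], vector [0, b, e], vector [d, e, c]]"

lemma csym_nth [simp]:
  "csym a b c d e $ 1 $ 1 = a" "csym a b c d e $ 1 $ 2 = 0" "csym a b c d e $ 1 $ 3 = d"
  "csym a b c d e $ 2 $ 1 = 0" "csym a b c d e $ 2 $ 2 = b" "csym a b c d e $ 2 $ 3 = e"
  "csym a b c d e $ 3 $ 1 = d" "csym a b c d e $ 3 $ 2 = e" "csym a b c d e $ 3 $ 3 = c"
  by (simp_all add: csym_def)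

lemma csym_in_clanV [simp]: "csym a b c d e \<in> clanV"
  by (simp add: clanV_def mat3_eq_iff transpose_def)

lemma clanV_csym:
  assumes "v \<in> clanV"
  shows "v = csym (v$1$1) (v$2$2) (v$3$3) (v$3$1) (v$3$2)"
proof -
  have z: "v$1$2 = 0" "v$2$1 = 0" and sym: "transpose v $ i $ j = v $ i $ j" for i j
    using assms by (simp_all add: clanV_def)
  show ?thesis
    using z sym[of 1 3] sym[of 2 3] by (simp add: mat3_eq_iff transpose_def)
qed

lemma clanV_cases:
  assumes "v \<in> clanV"
  obtains a b c d e where "v = csym a b c d e"
  using clanV_csym[OF assms] by blast

lemma subspace_clanV: "subspace clanV"
proof -
  have "transpose (u + v) = transpose u + transpose v" "transpose (r *\<^sub>R v) = r *\<^sub>R transpose v"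
    for u v :: "real^3^3" and r
    by (simp_all add: vec_eq_iff transpose_def)
  moreover have "transpose (0::real^3^3) = 0" by (simp add: vec_eq_iff transpose_def)
  ultimately show ?thesis by (simp add: subspace_def clanV_def)
qed

lemma lower_part_csym: "lower_part (csym a b c d e) = ltri (a / 2) (b / 2) (c / 2) d e"
  unfolding lower_part_def
proof (rule the_equality)
  fix L
  assume L: "lower_triangular L \<and> csym a b c d e = L + transpose L"
  then have "lower_triangular L" and eq: "csym a b c d e = L + transpose L" by auto
  have entry: "csym a b c d e $ i $ j = L $ i $ j + L $ j $ i" for i j
    unfolding eq by (simp add: transpose_def)
  show "L = ltri (a / 2) (b / 2) (c / 2) d e"
    using \<open>lower_triangular L\<close> entry[of 1 1] entry[of 2 2] entry[of 3 3] entry[of 2 1] entry[of 3 1] entry[of 3 2]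
    by (simp add: lower_triangular_def mat3_eq_iff)
qed (simp add: lower_triangular_def mat3_eq_iff transpose_def)

lemma clan_prod_csym:
  "clan_prod (csym a b c d e) (csym a' b' c' d' e') =
     csym (a * a') (b * b') (c * c' + 2 * d * d' + 2 * e * e')
       (d * a' + (a + c) / 2 * d') (e * b' + (b + c) / 2 * e')"
  by (simp add: clan_prod_def lower_part_csym mat3_eq_iff matrix_matrix_mult_def sum_3 transpose_def
      field_simps)

lemma clan_prod_closed: "u \<in> clanV \<Longrightarrow> v \<in> clanV \<Longrightarrow> clan_prod u v \<in> clanV"
  by (elim clanV_cases) (simp add: clan_prod_csym)

lemma linear_clan_prod: "linear (clan_prod u)"
  by (rule linearI)
    (simp_all add: clan_prod_def matrix_matrix_mult_def vec_eq_iff sum.distrib sum_distrib_left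
      algebra_simps)

text \<open>The spanning family \<open>e\<close> need not be independent.\<close>

lemma trace_on_eq:
  fixes f :: "'a::euclidean_space \<Rightarrow> 'a" and \<phi> :: "'i \<Rightarrow> 'a \<Rightarrow> real"
  assumes S: "subspace S" and f: "linear f" and fS: "\<And>v. v \<in> S \<Longrightarrow> f v \<in> S"
    and I: "finite I" and e: "\<And>i. i \<in> I \<Longrightarrow> e i \<in> S" and \<phi>: "\<And>i. i \<in> I \<Longrightarrow> linear (\<phi> i)"
    and expand: "\<And>v. v \<in> S \<Longrightarrow> (\<Sum>i\<in>I. \<phi> i v *\<^sub>R e i) = v"
  shows "trace_on S f = (\<Sum>i\<in>I. \<phi> i (f (e i)))"
proof -
  \<comment> \<open>The same choice as in \<open>trace_on\<close>; only the two basis properties are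
    known of it.\<close>
  define B where "B = (SOME B. independent B \<and> span B = S)"
  have "\<exists>B. independent B \<and> span B = S"
    using S by (metis basis_subspace_exists)
  then have B: "independent B" "span B = S"
    unfolding B_def by (metis (mono_tags, lifting) someI_ex)+
  then have fin: "finite B" using independent_bound by blast
  have BS: "b \<in> S" if "b \<in> B" for b using that B(2) span_base by blast
  have "trace_on S f = (\<Sum>b\<in>B. representation B (f b) b)"
    by (simp add: trace_on_def B_def Let_def)
  also have "\<dots> = (\<Sum>b\<in>B. representation B (\<Sum>i\<in>I. \<phi> i (f b) *\<^sub>R e i) b)"
    by (intro sum.cong refl) (simp add: expand fS BS)
  also have "\<dots> = (\<Sum>b\<in>B. \<Sum>i\<in>I. \<phi> i (f b) * representation B (e i) b)"
    by (intro sum.cong refl)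
      (simp add: representation_sum representation_scale B e span_scale S subspace_scale)
  \<comment> \<open>Exchanging the sums is the identity \<open>tr (S T) = tr (T S)\<close>; the
    inner sum then reassembles \<open>e i\<close> from its coordinates in \<open>B\<close>.\<close>
  also have "\<dots> = (\<Sum>i\<in>I. \<Sum>b\<in>B. representation B (e i) b * \<phi> i (f b))"
    by (subst sum.swap) (simp add: mult.commute)
  also have "\<dots> = (\<Sum>i\<in>I. \<phi> i (f (\<Sum>b\<in>B. representation B (e i) b *\<^sub>R b)))"
    using \<phi> f by (intro sum.cong refl) (simp add: linear_sum linear_scale)
  also have "\<dots> = (\<Sum>i\<in>I. \<phi> i (f (e i)))"
    by (intro sum.cong refl) (simp add: sum_representation_eq B fin e)
  finally show ?thesis .
qed

lemma trace_on_clanV: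
  assumes "linear f" "\<And>v. v \<in> clanV \<Longrightarrow> f v \<in> clanV"
  shows "trace_on clanV f = f (csym 1 0 0 0 0) $ 1 $ 1 + f (csym 0 1 0 0 0) $ 2 $ 2 +
    f (csym 0 0 1 0 0) $ 3 $ 3 + f (csym 0 0 0 1 0) $ 3 $ 1 + f (csym 0 0 0 0 1) $ 3 $ 2"
proof -
  \<comment> \<open>The functionals read only the diagonal and the lower entries, so the expansion
    reproduces \<open>v\<close> just for \<open>v\<close> in \<open>clanV\<close>.\<close>
  define \<phi> where "\<phi> i = [\<lambda>v::real^3^3. v$1$1, \<lambda>v. v$2$2, \<lambda>v. v$3$3, \<lambda>v. v$3$1, \<lambda>v. v$3$2] ! i" for i
  define e where "e i = [csym 1 0 0 0 0, csym 0 1 0 0 0, csym 0 0 1 0 0, csym 0 0 0 1 0, csym 0 0 0 0 1] ! i" for i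
  have "trace_on clanV f = (\<Sum>i<5. \<phi> i (f (e i)))"
  proof (rule trace_on_eq[OF subspace_clanV assms])
    show "e i \<in> clanV" if "i \<in> {..<5}" for i
      using that by (auto simp: e_def eval_nat_numeral less_Suc_eq)
    show "linear (\<phi> i)" if "i \<in> {..<5}" for i
      using that by (auto simp: \<phi>_def eval_nat_numeral less_Suc_eq intro!: linearI)
    show "(\<Sum>i<5. \<phi> i v *\<^sub>R e i) = v" if "v \<in> clanV" for v
      by (rule trans[OF _ clanV_csym[OF that, symmetric]])
        (simp add: \<phi>_def e_def eval_nat_numeral mat3_eq_iff)
  qed simp_all
  then show ?thesis by (simp add: \<phi>_def e_def eval_nat_numeral)
qed

text \<open>Multiplication by \<open>csym a b c d e\<close> has the diagonal \<open>a\<close>,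
  \<open>b\<close>, \<open>c\<close>, \<open>(a + c) / 2\<close>, \<open>(b + c) / 2\<close>, hence
  the trace \<open>3/2 a + 3/2 b + 2 c\<close>; this is evaluated at the clan product.\<close>

lemma Q_clan_csym:
  "Q_clan (csym a b c d e) (csym a' b' c' d' e') =
     3 / 2 * a * a' + 3 / 2 * b * b' + 2 * c * c' + 4 * d * d' + 4 * e * e'"
  unfolding Q_clan_def
  by (subst trace_on_clanV) (simp_all add: linear_clan_prod clan_prod_closed clan_prod_csym field_simps)

section \<open>Cholesky factors and the bijection between \<open>clanV\<close> and
  \<open>Omega\<close>\<close>

lemma ltri_mult_transpose:
  "ltri p q r s t ** transpose (ltri p q r s t) = csym (p\<^sup>2) (q\<^sup>2) (r\<^sup>2 + s\<^sup>2 + t\<^sup>2) (s * p) (t * q)"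
  by (simp add: mat3_eq_iff matrix_matrix_mult_def sum_3 transpose_def power2_eq_square)

text \<open>Comparing entries determines \<open>T\<close> successively, ending with
  \<open>T$3$3\<close>; positivity of the diagonal selects the square roots.\<close>

lemma cholesky_ltri:
  assumes "p > 0" "q > 0" "r > 0"
  shows "cholesky (ltri p q r s t ** transpose (ltri p q r s t)) = ltri p q r s t"
  unfolding cholesky_def
proof (rule the_equality)
  fix T :: "real^3^3"
  assume T: "lower_triangular T \<and> (\<forall>i. 0 < T $ i $ i) \<and>
    ltri p q r s t ** transpose (ltri p q r s t) = T ** transpose T"
  then have pos: "0 < T$1$1" "0 < T$2$2" "0 < T$3$3" and upper: "T$1$2 = 0" "T$1$3 = 0" "T$2$3 = 0"
    and eq: "csym (p\<^sup>2) (q\<^sup>2) (r\<^sup>2 + s\<^sup>2 + t\<^sup>2) (s * p) (t * q) = T ** transpose T"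
    by (auto simp: lower_triangular_def ltri_mult_transpose)
  have entry: "csym (p\<^sup>2) (q\<^sup>2) (r\<^sup>2 + s\<^sup>2 + t\<^sup>2) (s * p) (t * q) $ i $ j =
      T $ i $ 1 * T $ j $ 1 + T $ i $ 2 * T $ j $ 2 + T $ i $ 3 * T $ j $ 3" for i j
    by (simp add: eq matrix_matrix_mult_def sum_3 transpose_def)
  have 1: "T$1$1 = p" "T$2$1 = 0"
    using entry[of 1 1] entry[of 2 1] pos upper assms
    by (auto simp: power2_eq_square[symmetric] intro: power2_eq_imp_eq)
  then have 2: "T$2$2 = q" "T$3$1 = s"
    using entry[of 2 2] entry[of 3 1] pos upper assms
    by (auto simp: power2_eq_square[symmetric] intro: power2_eq_imp_eq)
  with 1 have 3: "T$3$2 = t"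
    using entry[of 3 2] upper assms by simp
  with 1 2 have "T$3$3 = r"
    using entry[of 3 3] pos assms
    by (auto simp: power2_eq_square[symmetric] intro: power2_eq_imp_eq)
  with 1 2 3 upper show "T = ltri p q r s t" by (simp add: mat3_eq_iff)
qed (use assms in \<open>simp add: lower_triangular_def forall_3\<close>)

lemma Exp_clan_csym_cholesky:
  "Exp_clan (csym a b c d e) = mat_exp (ltri (a/2) (b/2) (c/2) d e) ** transpose (mat_exp (ltri (a/2) (b/2) (c/2) d e))"
  by (simp add: Exp_clan_def lower_part_csym)

lemma Exp_clan_csym:
  "Exp_clan (csym a b c d e) = csym (exp a) (exp b)
     (exp c + (d * exp_dd (a/2) (c/2))\<^sup>2 + (e * exp_dd (b/2) (c/2))\<^sup>2)
     (d * exp_dd (a/2) (c/2) * exp (a/2)) (e * exp_dd (b/2) (c/2) * exp (b/2))"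
  by (simp add: Exp_clan_csym_cholesky mat_exp_ltri ltri_mult_transpose exp_double[symmetric])

text \<open>The exponential of the lower part is triangular with positive diagonal, so it is the
  Cholesky factor, and \<open>mat_log\<close> undoes it.\<close>

lemma Log_Exp_clan:
  assumes "v \<in> clanV"
  shows "Log_clan (Exp_clan v) = v"
proof -
  obtain a b c d e where v: "v = csym a b c d e" using assms by (rule clanV_cases)
  have "cholesky (Exp_clan v) = mat_exp (ltri (a/2) (b/2) (c/2) d e)"
    unfolding v Exp_clan_csym_cholesky mat_exp_ltri by (rule cholesky_ltri) simp_all
  then have "Log_clan (Exp_clan v) = ltri (a/2) (b/2) (c/2) d e + transpose (ltri (a/2) (b/2) (c/2) d e)"
    by (simp only: Log_clan_def mat_log_mat_exp_ltri)
  then show ?thesis by (simp add: v mat3_eq_iff transpose_def)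
qed

text \<open>The quadratic form of \<open>T ** transpose T\<close> is the squared norm of
  \<open>transpose T *v u\<close>, and \<open>transpose T\<close> is injective.\<close>

lemma ltri_mult_transpose_Omega:
  assumes "p > 0" "q > 0" "r > 0"
  shows "ltri p q r s t ** transpose (ltri p q r s t) \<in> Omega"
proof -
  let ?T = "ltri p q r s t"
  have "0 < u \<bullet> ((?T ** transpose ?T) *v u)" if "u \<noteq> 0" for u
  proof -
    have "transpose ?T *v u \<noteq> 0"
      using that assms by (auto simp: vec_eq_iff forall_3 matrix_vector_mult_def sum_3 transpose_def)
    then have "0 < (transpose ?T *v u) \<bullet> (transpose ?T *v u)" by simp
    then show ?thesis
      by (simp add: matrix_vector_mul_assoc[symmetric] dot_lmul_matrix[symmetric] transpose_matrix_vector)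
  qed
  then show ?thesis by (simp add: Omega_def ltri_mult_transpose)
qed

lemma Exp_clan_Omega: "v \<in> clanV \<Longrightarrow> Exp_clan v \<in> Omega"
  by (elim clanV_cases) (simp add: Exp_clan_csym_cholesky mat_exp_ltri ltri_mult_transpose_Omega)

lemma Omega_csym_pos:
  assumes "csym a b c d e \<in> Omega"
  shows "a > 0" "b > 0" "c - d\<^sup>2 / a - e\<^sup>2 / b > 0"
proof -
  have pd: "0 < u \<bullet> (csym a b c d e *v u)" if "u \<noteq> 0" for u
    using assms that by (simp add: Omega_def)
  have q: "u \<bullet> (csym a b c d e *v u) = a * (u$1)\<^sup>2 + b * (u$2)\<^sup>2 + c * (u$3)\<^sup>2
      + 2 * d * u$1 * u$3 + 2 * e * u$2 * u$3" for u
    by (simp add: inner_vec_def matrix_vector_mult_def sum_3 power2_eq_square algebra_simps)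
  show a: "a > 0" using pd[of "vector [1, 0, 0]"] unfolding q by (simp add: vec_eq_iff forall_3)
  show b: "b > 0" using pd[of "vector [0, 1, 0]"] unfolding q by (simp add: vec_eq_iff forall_3)
  \<comment> \<open>The form is minimal among vectors with third coordinate 1 at
    \<open>(- d / a, - e / b, 1)\<close>; its value there is the Schur complement of the diagonal
    block.\<close>
  have "a * (- d / a)\<^sup>2 + b * (- e / b)\<^sup>2 + c + 2 * d * (- d / a) + 2 * e * (- e / b)
      = c - d\<^sup>2 / a - e\<^sup>2 / b"
    using a b by (simp add: power2_eq_square field_simps)
  then show "c - d\<^sup>2 / a - e\<^sup>2 / b > 0"
    using pd[of "vector [- d / a, - e / b, 1]"] unfolding q by (simp add: vec_eq_iff forall_3)
qed

text \<open>An explicit formula for \<open>Log_clan\<close> on \<open>Omega\<close>, found by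
  solving \<open>Exp_clan_csym\<close> for its arguments. The Schur complement
  \<open>\<delta>\<close> is the square of the last diagonal Cholesky entry. Unlike
  \<open>Log_clan\<close>, the formula can be differentiated in all matrix directions.\<close>

definition clan_log :: "real^3^3 \<Rightarrow> real^3^3" where
  "clan_log x = (let a = x$1$1; b = x$2$2; \<delta> = x$3$3 - (x$3$1)\<^sup>2 / a - (x$3$2)\<^sup>2 / b in
     csym (ln a) (ln b) (ln \<delta>) (x$3$1 / (sqrt a * exp_dd (ln a / 2) (ln \<delta> / 2)))
       (x$3$2 / (sqrt b * exp_dd (ln b / 2) (ln \<delta> / 2))))"

lemma exp_half_ln: "a > 0 \<Longrightarrow> exp (ln a / 2) = sqrt a" for a :: real
  by (simp add: ln_sqrt[symmetric])

lemma Exp_clan_log: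
  assumes "x \<in> Omega"
  shows "Exp_clan (clan_log x) = x"
proof -
  have "x \<in> clanV" using assms by (simp add: Omega_def)
  then obtain a b c d e where x: "x = csym a b c d e" by (rule clanV_cases)
  note pos = Omega_csym_pos[OF assms[unfolded x]]
  have "exp_dd s t \<noteq> 0" for s t :: real using exp_dd_pos[of s t] by simp
  then show ?thesis using pos
    by (simp add: x clan_log_def Let_def Exp_clan_csym exp_half_ln mat3_eq_iff power_divide power_mult_distrib)
qed

lemma clan_log_clanV [simp]: "clan_log x \<in> clanV"
  by (simp add: clan_log_def Let_def)

text \<open>Points of \<open>Omega\<close> are exponentials by \<open>Exp_clan_log\<close>, so
  \<open>Log_Exp_clan\<close> applies.\<close>

lemma Log_clan_eq: "x \<in> Omega \<Longrightarrow> Log_clan x = clan_log x"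
  by (metis Exp_clan_log Log_Exp_clan clan_log_clanV)

lemma Log_clan_clanV: "x \<in> Omega \<Longrightarrow> Log_clan x \<in> clanV"
  by (simp add: Log_clan_eq)

lemma Exp_Log_clan: "x \<in> Omega \<Longrightarrow> Exp_clan (Log_clan x) = x"
  by (simp add: Log_clan_eq Exp_clan_log)

lemma det_ltri: "det (ltri a b c d e) = a * b * c"
  by (simp add: det_3)

lemma det_Exp_clan:
  assumes "v \<in> clanV"
  shows "det (Exp_clan v) = exp (v$1$1 + v$2$2 + v$3$3)"
proof -
  obtain a b c d e where v: "v = csym a b c d e" using assms by (rule clanV_cases)
  have "det (Exp_clan v) = (exp (a/2) * exp (b/2) * exp (c/2))\<^sup>2"
    by (simp add: v Exp_clan_csym_cholesky mat_exp_ltri det_mul det_ltri power2_eq_square)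
  also have "\<dots> = exp (a + b + c)"
    by (simp add: power_mult_distrib exp_double[symmetric] exp_add)
  finally show ?thesis by (simp add: v)
qed

text \<open>Coordinates on \<^const>\<open>clanV\<close> that turn \<^const>\<open>Q_clan\<close> into the Euclidean inner product.\<close>

definition clan_coord :: "real^3^3 \<Rightarrow> real \<times> real \<times> real \<times> real \<times> real" where
  "clan_coord v = (sqrt (3/2) * v$1$1, sqrt (3/2) * v$2$2, sqrt 2 * v$3$3, 2 * v$3$1, 2 * v$3$2)"

lemma bounded_linear_clan_coord: "bounded_linear clan_coord"
  by (rule bounded_linear_euclideanI) (simp_all add: clan_coord_def algebra_simps)

lemma Q_clan_norm:
  assumes "v \<in> clanV"
  shows "sqrt (Q_clan v v) = norm (clan_coord v)"
proof -
  obtain a b c d e where v: "v = csym a b c d e" using assms by (rule clanV_cases)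
  show ?thesis
    by (simp add: v Q_clan_csym clan_coord_def norm_Pair power_mult_distrib mult.assoc flip: power2_eq_square)
qed

lemma clan_coord_eq_0:
  assumes "v \<in> clanV" "clan_coord v = 0"
  shows "v = 0"
  using assms(2) by (subst clanV_csym[OF assms(1)]) (simp add: clan_coord_def zero_prod_def mat3_eq_iff)

section \<open>The Riemannian distance\<close>

text \<open>Reduces smoothness in two variables to that of the one-variable function
  \<open>(e^z - 1) / z\<close>.\<close>

lemma exp_dd_shift: "exp_dd s t = exp t * exp_dd (s - t) 0" for s t :: real
  by (simp add: exp_dd_def exp_diff field_simps)

text \<open>The singularity at 0 is removed by the everywhere convergent series with coefficients
  \<open>1 / (n + 1)!\<close>, differentiated termwise.\<close>

lemma exp_dd_0_C1:
  obtains \<phi>' :: "real \<Rightarrow> real" where "\<And>z. ((\<lambda>z. exp_dd z 0) has_field_derivative \<phi>' z) (at z)"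
    and "continuous_on UNIV \<phi>'"
proof -
  let ?c = "\<lambda>n. 1 / fact (Suc n) :: real"
  have s: "(\<lambda>n. ?c n * z ^ n) sums exp_dd z 0" for z
  proof -
    have "(\<lambda>n. (1 / fact (Suc n)) *\<^sub>R pow_diff ((*) z) 0 (Suc n) 1) sums exp_dd z 0"
      using exp_dd_sums[of z 0] by (subst sums_Suc_iff) simp
    then show ?thesis by (simp add: funpow_mult_one del: fact_Suc)
  qed
  then have sm: "summable (\<lambda>n. ?c n * z ^ n)" for z by (rule sums_summable)
  have eq: "(\<lambda>z. \<Sum>n. ?c n * z ^ n) = (\<lambda>z. exp_dd z 0)"
    using s by (intro ext) (rule sums_unique[symmetric])
  show ?thesis
  proof
    show "((\<lambda>z. exp_dd z 0) has_field_derivative (\<Sum>n. diffs ?c n * z ^ n)) (at z)" for z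
      using termdiffs_strong_converges_everywhere[of ?c z, OF sm] unfolding eq .
    show "continuous_on UNIV (\<lambda>z. \<Sum>n. diffs ?c n * z ^ n)"
      using isCont_powser_converges_everywhere[of "diffs ?c", OF termdiff_converges_all[OF sm]]
      by (simp add: continuous_at_imp_continuous_on)
  qed
qed

text \<open>Exhibits \<open>csym\<close> as a combination of constant matrices, so that the closure
  rules for sums and scalar multiples yield differentiability.\<close>

lemma csym_expand:
  "csym a b c d e = a *\<^sub>R csym 1 0 0 0 0 + b *\<^sub>R csym 0 1 0 0 0 + c *\<^sub>R csym 0 0 1 0 0 +
     d *\<^sub>R csym 0 0 0 1 0 + e *\<^sub>R csym 0 0 0 0 1"
  by (simp add: mat3_eq_iff)

lemma differentiable_real_compose:
  fixes f :: "'a::real_normed_vector \<Rightarrow> real"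
  assumes "f differentiable (at x)" "(g has_field_derivative g') (at (f x))"
  shows "(\<lambda>x. g (f x)) differentiable (at x)"
proof -
  obtain f' where "(f has_derivative f') (at x)" using assms(1) by (auto simp: differentiable_def)
  then have "((\<lambda>x. g (f x)) has_derivative (\<lambda>h. (*) g' (f' h))) (at x)"
    by (rule has_derivative_compose) (use assms(2) in \<open>simp add: has_field_derivative_def\<close>)
  then show ?thesis by (auto simp: differentiable_def)
qed

lemma differentiable_exp_dd:
  fixes f g :: "'a::real_normed_vector \<Rightarrow> real"
  assumes "f differentiable (at x)" "g differentiable (at x)"
  shows "(\<lambda>x. exp_dd (f x) (g x)) differentiable (at x)"
proof -
  obtain \<phi>' where d: "\<And>z. ((\<lambda>z::real. exp_dd z 0) has_field_derivative \<phi>' z) (at z)"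
    using exp_dd_0_C1 by blast
  have "(\<lambda>x. exp_dd (f x - g x) 0) differentiable (at x)"
    using differentiable_diff[OF assms] by (rule differentiable_real_compose) (rule d)
  moreover have "(\<lambda>x. exp (g x)) differentiable (at x)"
    using assms(2) by (rule differentiable_real_compose) (rule DERIV_exp)
  ultimately show ?thesis
    by (subst exp_dd_shift) (intro differentiable_mult)
qed

lemma differentiable_clan_log:
  assumes "x \<in> Omega"
  shows "clan_log differentiable (at x)"
proof -
  define \<delta> where "\<delta> x = x$3$3 - (x$3$1)\<^sup>2 / x$1$1 - (x$3$2)\<^sup>2 / x$2$2" for x :: "real^3^3"
  have "x \<in> clanV" using assms by (simp add: Omega_def)
  then obtain a b c d e where x: "x = csym a b c d e" by (rule clanV_cases)
  have pos: "x$1$1 > 0" "x$2$2 > 0" "\<delta> x > 0"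
    using Omega_csym_pos[OF assms[unfolded x]] by (simp_all add: x \<delta>_def)
  have n [simp]: "(\<lambda>x::real^3^3. x $ i $ j) differentiable (at x)" for i j
    by (intro bounded_linear_imp_differentiable bounded_linear_euclideanI) simp_all
  have [simp]: "\<delta> differentiable (at x)"
    unfolding \<delta>_def[abs_def] using pos by (intro differentiable_diff differentiable_divide differentiable_power n) simp_all
  have ln [simp]: "(\<lambda>x. ln (f x)) differentiable (at x)"
    if "f differentiable (at x)" "f x > 0" for f :: "real^3^3 \<Rightarrow> real"
    using that by (intro differentiable_real_compose[OF _ DERIV_ln])
  have [simp]: "(\<lambda>x. sqrt (f x)) differentiable (at x)"
    if "f differentiable (at x)" "f x > 0" for f :: "real^3^3 \<Rightarrow> real"
    using that by (intro differentiable_real_compose[OF _ DERIV_real_sqrt])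
  have [simp]: "exp_dd s t \<noteq> 0" for s t :: real using exp_dd_pos[of s t] by simp
  have eq: "clan_log = (\<lambda>x. csym (ln (x$1$1)) (ln (x$2$2)) (ln (\<delta> x))
     (x$3$1 / (sqrt (x$1$1) * exp_dd (ln (x$1$1) / 2) (ln (\<delta> x) / 2)))
     (x$3$2 / (sqrt (x$2$2) * exp_dd (ln (x$2$2) / 2) (ln (\<delta> x) / 2))))"
    by (rule ext) (simp add: clan_log_def \<delta>_def Let_def)
  show ?thesis
    unfolding eq using pos
    by (subst csym_expand)
      (intro differentiable_add differentiable_scaleR differentiable_const differentiable_divide
        differentiable_mult differentiable_exp_dd; simp)
qed

text \<open>Transferred from \<open>clan_log\<close>, which agrees with \<open>Log_clan\<close> on
  \<open>Omega\<close>. Within \<open>Omega\<close> the derivative is not unique off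
  \<open>clanV\<close>, hence the formulation with the chosen \<open>frechet_derivative\<close> of
  \<open>clan_metric\<close>.\<close>

lemma Log_clan_has_derivative:
  assumes "x \<in> Omega"
  shows "(Log_clan has_derivative frechet_derivative Log_clan (at x within Omega)) (at x within Omega)"
proof -
  obtain D where "(clan_log has_derivative D) (at x within Omega)"
    using differentiable_clan_log[OF assms] has_derivative_at_withinI by (metis differentiable_def)
  then have "(Log_clan has_derivative D) (at x within Omega)"
    by (rule has_derivative_transform[rotated 2]) (simp_all add: assms Log_clan_eq)
  then show ?thesis by (simp add: differentiableI frechet_derivative_works[symmetric])
qed

lemma C1_real_compose:
  fixes f g :: "real \<Rightarrow> real"
  assumes f: "f C1_differentiable_on S" and g: "\<And>z. (g has_field_derivative g' z) (at z)"
    and g': "continuous_on UNIV g'"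
  shows "(\<lambda>t. g (f t)) C1_differentiable_on S"
proof -
  obtain f' where f': "\<And>t. t \<in> S \<Longrightarrow> (f has_vector_derivative f' t) (at t)" "continuous_on S f'"
    using f by (auto simp: C1_differentiable_on_def)
  have "continuous_on S f"
    using f'(1) by (meson continuous_at_imp_continuous_on has_vector_derivative_continuous)
  then have "continuous_on S (\<lambda>t. f' t * g' (f t))"
    by (intro continuous_on_mult f'(2) continuous_on_compose2[OF g']) auto
  moreover have "((\<lambda>t. g (f t)) has_vector_derivative f' t * g' (f t)) (at t)" if "t \<in> S" for t
    using field_vector_diff_chain_at[OF f'(1)[OF that] g] by (simp add: o_def)
  ultimately show ?thesis
    unfolding C1_differentiable_on_def by (intro exI[of _ "\<lambda>t. f' t * g' (f t)"]) blast
qed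

lemma C1_exp_dd:
  fixes f g :: "real \<Rightarrow> real"
  assumes "f C1_differentiable_on S" "g C1_differentiable_on S"
  shows "(\<lambda>t. exp_dd (f t) (g t)) C1_differentiable_on S"
proof -
  obtain \<phi>' where d: "\<And>z. ((\<lambda>z::real. exp_dd z 0) has_field_derivative \<phi>' z) (at z)"
    "continuous_on UNIV \<phi>'"
    using exp_dd_0_C1 by blast
  have "(\<lambda>t. exp_dd (f t - g t) 0) C1_differentiable_on S"
    using C1_differentiable_on_diff[OF assms] d by (rule C1_real_compose)
  moreover have "(\<lambda>t. exp (g t)) C1_differentiable_on S"
    using assms(2) DERIV_exp continuous_on_exp[OF continuous_on_id] by (rule C1_real_compose)
  ultimately show ?thesis
    by (subst exp_dd_shift) (intro C1_differentiable_on_mult)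
qed

lemma C1_Exp_clan_line:
  assumes "u \<in> clanV" "v \<in> clanV"
  shows "(\<lambda>t. Exp_clan (u + t *\<^sub>R v)) C1_differentiable_on S"
proof -
  obtain a b c d e where u: "u = csym a b c d e" using assms(1) by (rule clanV_cases)
  obtain a' b' c' d' e' where v: "v = csym a' b' c' d' e'" using assms(2) by (rule clanV_cases)
  have eq: "u + t *\<^sub>R v = csym (a + t * a') (b + t * b') (c + t * c') (d + t * d') (e + t * e')" for t
    by (simp add: u v mat3_eq_iff)
  have [simp]: "(\<lambda>t::real. p + t * q) C1_differentiable_on S" for p q
    unfolding C1_differentiable_on_def
    by (intro exI[of _ "\<lambda>_. q"]) (auto intro!: derivative_eq_intros)
  have [simp]: "(\<lambda>t::real. (p + t * q) / 2) C1_differentiable_on S" for p q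
    unfolding C1_differentiable_on_def
    by (intro exI[of _ "\<lambda>_. q / 2"]) (auto intro!: derivative_eq_intros)
  have [simp]: "(\<lambda>t. exp (f t)) C1_differentiable_on S" if "f C1_differentiable_on S"
    for f :: "real \<Rightarrow> real"
    using that DERIV_exp continuous_on_exp[OF continuous_on_id] by (rule C1_real_compose)
  show ?thesis
    unfolding eq Exp_clan_csym power2_eq_square
    by (subst csym_expand)
      (intro C1_differentiable_on_add C1_differentiable_on_scaleR C1_differentiable_on_const
        C1_differentiable_on_mult C1_exp_dd; simp)
qed

text \<open>By the chain rule, \<open>Log_clan\<close> turns the Riemannian speed into the Euclidean
  speed of the coordinate curve. At interior times the derivative within the interval is the full
  one.\<close>

lemma clan_speed_eq:
  assumes \<gamma>: "path_image \<gamma> \<subseteq> Omega" and t: "t \<in> {0<..<1}" and diff: "\<gamma> differentiable (at t)"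
  obtains c where "((\<lambda>t. clan_coord (Log_clan (\<gamma> t))) has_vector_derivative c) (at t)"
    and "clan_speed \<gamma> t = norm c"
proof -
  define D where "D = frechet_derivative Log_clan (at (\<gamma> t) within Omega)"
  define d where "d = D (vector_derivative \<gamma> (at t))"
  have \<gamma>s: "\<gamma> s \<in> Omega" if "s \<in> {0<..<1}" for s
    using that \<gamma> by (auto simp: path_image_def)
  have at: "at t within {0<..<1} = at t" using t by (intro at_within_open) simp_all
  have v: "(\<gamma> has_vector_derivative vector_derivative \<gamma> (at t)) (at t within {0<..<1})"
    using diff by (simp add: vector_derivative_works has_vector_derivative_at_within)
  have "(Log_clan has_derivative D) (at (\<gamma> t) within \<gamma> ` {0<..<1})"
    unfolding D_def by (rule has_derivative_subset[OF Log_clan_has_derivative]) (use \<gamma>s t in auto)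
  then have L: "((\<lambda>t. Log_clan (\<gamma> t)) has_vector_derivative d) (at t)"
    using vector_derivative_diff_chain_within[OF v] by (simp add: at o_def d_def)
  txt \<open>\<open>P\<close> vanishes on \<^const>\<open>clanV\<close> only, so the velocity of the logarithm lies in \<^const>\<open>clanV\<close>.\<close>
  define P where "P v = v - csym (v$1$1) (v$2$2) (v$3$3) (v$3$1) (v$3$2)" for v
  have "bounded_linear P"
    by (rule bounded_linear_euclideanI) (simp_all add: P_def mat3_eq_iff algebra_simps)
  from bounded_linear.has_vector_derivative[OF this L]
  have "((\<lambda>t. P (Log_clan (\<gamma> t))) has_vector_derivative P d) (at t)" .
  moreover have "P (Log_clan (\<gamma> s)) = 0" if "s \<in> {0<..<1}" for s
    using clanV_csym[OF Log_clan_clanV[OF \<gamma>s[OF that]]] by (simp add: P_def)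
  ultimately have "((\<lambda>t. 0) has_vector_derivative P d) (at t)"
    using has_vector_derivative_transform_within_open[of _ "P d" t "{0<..<1}" "\<lambda>t. 0"] t
    by (metis open_greaterThanLessThan)
  then have "P d = 0"
    by (rule vector_derivative_unique_at) (rule has_vector_derivative_const)
  then have "d \<in> clanV"
    by (metis P_def csym_in_clanV eq_iff_diff_eq_0)
  then have "clan_speed \<gamma> t = norm (clan_coord d)"
    by (simp add: clan_speed_def clan_metric_def Let_def Q_clan_norm flip: D_def d_def)
  with bounded_linear.has_vector_derivative[OF bounded_linear_clan_coord L] show ?thesis
    by (rule that)
qed

text \<open>The displacement of the coordinate curve is the integral of its velocity, whose norm is
  at most the integral of the speed.\<close>

lemma clan_length_ge:
  assumes \<gamma>: "valid_path \<gamma>" "path_image \<gamma> \<subseteq> Omega" "clan_speed \<gamma> integrable_on {0..1}"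
  shows "norm (clan_coord (Log_clan (\<gamma> 1)) - clan_coord (Log_clan (\<gamma> 0))) \<le> integral {0..1} (clan_speed \<gamma>)"
proof -
  define \<Psi> where "\<Psi> t = clan_coord (Log_clan (\<gamma> t))" for t
  obtain S where S: "finite S" "\<gamma> C1_differentiable_on {0..1} - S" and cont: "continuous_on {0..1} \<gamma>"
    using \<gamma>(1) by (auto simp: valid_path_def piecewise_C1_differentiable_on_def)
  \<comment> \<open>The endpoints are included because \<open>clan_speed_eq\<close> concerns
    interior times only.\<close>
  let ?N = "S \<union> {0, 1}"
  have der: "(\<Psi> has_vector_derivative vector_derivative \<Psi> (at t)) (at t)"
      "clan_speed \<gamma> t = norm (vector_derivative \<Psi> (at t))" if "t \<in> {0..1} - ?N" for t
  proof -
    have "\<gamma> differentiable (at t)" using S(2) that by (simp add: C1_differentiable_on_eq)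
    moreover have "t \<in> {0<..<1}" using that by auto
    ultimately obtain c where "(\<Psi> has_vector_derivative c) (at t)" "clan_speed \<gamma> t = norm c"
      using clan_speed_eq[OF \<gamma>(2)] unfolding \<Psi>_def by blast
    then show "(\<Psi> has_vector_derivative vector_derivative \<Psi> (at t)) (at t)"
      "clan_speed \<gamma> t = norm (vector_derivative \<Psi> (at t))"
      by (simp_all add: vector_derivative_at)
  qed
  have "continuous_on Omega Log_clan"
    by (rule has_derivative_continuous_on) (rule Log_clan_has_derivative)
  then have "continuous_on {0..1} (\<lambda>t. Log_clan (\<gamma> t))"
    by (rule continuous_on_compose2[OF _ cont]) (use \<gamma>(2) in \<open>auto simp: path_image_def\<close>)
  then have "continuous_on {0..1} \<Psi>"
    unfolding \<Psi>_def by (intro bounded_linear.continuous_on[OF bounded_linear_clan_coord])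
  then have "((\<lambda>t. vector_derivative \<Psi> (at t)) has_integral (\<Psi> 1 - \<Psi> 0)) {0..1}"
    using S(1) der(1) by (intro fundamental_theorem_of_calculus_interior_strong[of ?N]) auto
  \<comment> \<open>Both integrands are reset to 0 on the finite set \<open>?N\<close>, so that they
    can be compared at every point of the interval.\<close>
  then have I: "((\<lambda>t. if t \<in> ?N then 0 else vector_derivative \<Psi> (at t)) has_integral (\<Psi> 1 - \<Psi> 0)) {0..1}"
    by (rule has_integral_spike_finite[of ?N, rotated 2]) (use S(1) in auto)
  have J: "((\<lambda>t. if t \<in> ?N then 0 else clan_speed \<gamma> t) has_integral integral {0..1} (clan_speed \<gamma>)) {0..1}"
    by (rule has_integral_spike_finite[of ?N _ _ "clan_speed \<gamma>"]) (use S(1) \<gamma>(3) in auto)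
  have "norm (\<Psi> 1 - \<Psi> 0) \<le> integral {0..1} (clan_speed \<gamma>)"
    unfolding integral_unique[OF I, symmetric] integral_unique[OF J, symmetric]
    by (rule integral_norm_bound_integral) (use I J der(2) in auto)
  then show ?thesis by (simp add: \<Psi>_def)
qed

lemma clan_length_line:
  assumes "u \<in> clanV" "v \<in> clanV"
  defines "\<gamma> \<equiv> \<lambda>t. Exp_clan (u + t *\<^sub>R v)"
  shows "valid_path \<gamma>" "path_image \<gamma> \<subseteq> Omega"
    and "(clan_speed \<gamma> has_integral norm (clan_coord v)) {0..1}"
proof -
  have C1: "\<gamma> C1_differentiable_on S" for S
    unfolding \<gamma>_def using assms(1,2) by (rule C1_Exp_clan_line)
  then show "valid_path \<gamma>" by (simp add: valid_path_def C1_differentiable_imp_piecewise)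
  have V: "u + t *\<^sub>R v \<in> clanV" for t
    using assms(1,2) subspace_clanV by (simp add: subspace_add subspace_scale)
  show im: "path_image \<gamma> \<subseteq> Omega"
    by (auto simp: path_image_def \<gamma>_def Exp_clan_Omega V)
  interpret bounded_linear clan_coord by (rule bounded_linear_clan_coord)
  have "((\<lambda>t. clan_coord (Log_clan (\<gamma> t))) has_vector_derivative clan_coord v) (at t)" for t
    by (auto simp: \<gamma>_def Log_Exp_clan V add scaleR intro!: derivative_eq_intros)
  \<comment> \<open>The derivative supplied by \<open>clan_speed_eq\<close> is
    \<open>clan_coord v\<close> by uniqueness.\<close>
  then have speed: "clan_speed \<gamma> t = norm (clan_coord v)" if "t \<in> {0<..<1}" for t
    using clan_speed_eq[OF im that] C1[of UNIV] vector_derivative_unique_at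
    by (metis C1_differentiable_on_eq UNIV_I)
  show "(clan_speed \<gamma> has_integral norm (clan_coord v)) {0..1}"
  proof (rule has_integral_spike_finite[of "{0, 1}"])
    show "((\<lambda>t. norm (clan_coord v)) has_integral norm (clan_coord v)) {0..1::real}"
      using has_integral_const_real[of "norm (clan_coord v)" 0 1] by simp
  qed (use speed in auto)
qed

text \<open>The infimum is attained by the curve whose logarithm is the straight segment;
  \<open>clan_length_ge\<close> bounds all other lengths from below.\<close>

lemma clan_dist_eq:
  assumes "x \<in> Omega" "y \<in> Omega"
  shows "clan_dist x y = norm (clan_coord (Log_clan x) - clan_coord (Log_clan y))"
  unfolding clan_dist_def
proof (rule cInf_eq_minimum)
  interpret bounded_linear clan_coord by (rule bounded_linear_clan_coord)
  let ?u = "Log_clan x" and ?v = "Log_clan y - Log_clan x"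
  let ?\<gamma> = "\<lambda>t. Exp_clan (?u + t *\<^sub>R ?v)"
  have V: "?u \<in> clanV" "?v \<in> clanV"
    using assms subspace_clanV by (simp_all add: Log_clan_clanV subspace_diff)
  note line = clan_length_line[OF V]
  have "pathstart ?\<gamma> = x" "pathfinish ?\<gamma> = y"
    using assms by (simp_all add: pathstart_def pathfinish_def Exp_Log_clan)
  moreover have "integral {0..1} (clan_speed ?\<gamma>) = norm (clan_coord (Log_clan x) - clan_coord (Log_clan y))"
    using integral_unique[OF line(3)] by (simp add: diff norm_minus_commute)
  ultimately show "norm (clan_coord (Log_clan x) - clan_coord (Log_clan y)) \<in>
    {integral {0..1} (clan_speed \<gamma>) |\<gamma>. valid_path \<gamma> \<and> path_image \<gamma> \<subseteq> Omega \<and>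
      pathstart \<gamma> = x \<and> pathfinish \<gamma> = y \<and> clan_speed \<gamma> integrable_on {0..1}}"
    using line by (intro CollectI exI[of _ ?\<gamma>]) auto
  show "norm (clan_coord (Log_clan x) - clan_coord (Log_clan y)) \<le> l"
    if "l \<in> {integral {0..1} (clan_speed \<gamma>) |\<gamma>. valid_path \<gamma> \<and> path_image \<gamma> \<subseteq> Omega \<and>
      pathstart \<gamma> = x \<and> pathfinish \<gamma> = y \<and> clan_speed \<gamma> integrable_on {0..1}}" for l
    using that clan_length_ge by (auto simp: pathstart_def pathfinish_def norm_minus_commute)
qed

section \<open>The weighted mean\<close>

text \<open>The Leibniz, or parallel axis, identity: expanding around \<open>m\<close>, the cross
  terms cancel because the weighted deviations from the mean sum to 0.\<close>

lemma weighted_sum_norm_squared: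
  fixes q :: "'i \<Rightarrow> 'a::real_inner"
  assumes "(\<Sum>i\<in>I. w i) = 1"
  defines "m \<equiv> \<Sum>i\<in>I. w i *\<^sub>R q i"
  shows "(\<Sum>i\<in>I. w i * (norm (p - q i))\<^sup>2) = (norm (p - m))\<^sup>2 + (\<Sum>i\<in>I. w i * (norm (m - q i))\<^sup>2)"
proof -
  have "(norm (p - q i))\<^sup>2 = (norm (p - m))\<^sup>2 + 2 * ((p - m) \<bullet> (m - q i)) + (norm (m - q i))\<^sup>2" for i
    by (simp add: power2_norm_eq_inner inner_diff inner_commute)
  then have "(\<Sum>i\<in>I. w i * (norm (p - q i))\<^sup>2) = (\<Sum>i\<in>I. w i) * (norm (p - m))\<^sup>2
      + 2 * ((p - m) \<bullet> (\<Sum>i\<in>I. w i *\<^sub>R (m - q i))) + (\<Sum>i\<in>I. w i * (norm (m - q i))\<^sup>2)"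
    by (simp add: distrib_left sum.distrib sum_distrib_right sum_distrib_left inner_sum_right mult.left_commute)
  moreover have "(\<Sum>i\<in>I. w i *\<^sub>R (m - q i)) = 0"
    using assms(1) by (simp add: scaleR_diff_right sum_subtractf m_def flip: scaleR_sum_left)
  ultimately show ?thesis using assms(1) by simp
qed

theorem theorem7p15:
  fixes N :: nat and w :: "nat \<Rightarrow> real" and x :: "nat \<Rightarrow> real^3^3"
  assumes "\<And>i. i \<in> {1..N} \<Longrightarrow> x i \<in> Omega"
    and "\<And>i. i \<in> {1..N} \<Longrightarrow> 0 < w i"
    and "(\<Sum>i=1..N. w i) = 1"
  shows "(\<forall>z. is_arg_min (frechet_functional N w x) (\<lambda>z. z \<in> Omega) z \<longleftrightarrow> z = clan_mean N w x) \<and>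
    det (clan_mean N w x) = (\<Prod>i=1..N. det (x i) powr w i)"
proof (intro conjI allI)
  let ?m = "\<Sum>i=1..N. w i *\<^sub>R Log_clan (x i)" and ?F = "frechet_functional N w x"
  have m: "?m \<in> clanV"
    using assms(1) by (intro subspace_sum subspace_scale subspace_clanV Log_clan_clanV)
  then have mean: "clan_mean N w x \<in> Omega" "Log_clan (clan_mean N w x) = ?m"
    by (simp_all add: clan_mean_def Exp_clan_Omega Log_Exp_clan)
  interpret bounded_linear clan_coord by (rule bounded_linear_clan_coord)
  have F: "?F z = (norm (clan_coord (Log_clan z - ?m)))\<^sup>2 + ?F (clan_mean N w x)" if "z \<in> Omega" for z
  proof -
    have "?F z = (\<Sum>i=1..N. w i * (norm (clan_coord (Log_clan z) - clan_coord (Log_clan (x i))))\<^sup>2)"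
      if "z \<in> Omega" for z
      using that assms(1) by (simp add: frechet_functional_def clan_dist_eq)
    \<comment> \<open>The constant in the Leibniz identity is the functional at the mean, whose
      logarithm is \<open>?m\<close>.\<close>
    from this[OF that] this[OF mean(1)] show ?thesis
      unfolding mean(2) by (subst (asm) weighted_sum_norm_squared[OF assms(3)]) (simp add: diff sum scaleR)
  qed
  show "is_arg_min ?F (\<lambda>z. z \<in> Omega) z \<longleftrightarrow> z = clan_mean N w x" for z
  proof
    assume min: "is_arg_min ?F (\<lambda>z. z \<in> Omega) z"
    then have z: "z \<in> Omega" by (simp add: is_arg_min_def)
    have "\<not> ?F (clan_mean N w x) < ?F z" using min mean(1) by (auto simp: is_arg_min_def)
    then have "clan_coord (Log_clan z - ?m) = 0" using F[OF z] by simp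
    moreover have "Log_clan z - ?m \<in> clanV"
      using z m subspace_clanV by (simp add: Log_clan_clanV subspace_diff)
    ultimately have "Log_clan z = ?m" using clan_coord_eq_0 by fastforce
    then show "z = clan_mean N w x" using Exp_Log_clan[OF z] by (simp add: clan_mean_def)
  next
    have "?F (clan_mean N w x) \<le> ?F z" if "z \<in> Omega" for z
      by (subst F[OF that]) simp
    then show "is_arg_min ?F (\<lambda>z. z \<in> Omega) z" if "z = clan_mean N w x"
      using mean(1) that by (simp add: is_arg_min_linorder)
  qed
  \<comment> \<open>In this form \<open>ln (det z)\<close> is linear in \<open>Log_clan z\<close>,
    and the determinants are positive, so that \<open>powr\<close> is
    \<open>exp (w i * ln (det (x i)))\<close>.\<close>
  have det: "det z = exp (Log_clan z $ 1 $ 1 + Log_clan z $ 2 $ 2 + Log_clan z $ 3 $ 3)" if "z \<in> Omega" for z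
    using det_Exp_clan[OF Log_clan_clanV[OF that]] by (simp add: Exp_Log_clan that)
  show "det (clan_mean N w x) = (\<Prod>i=1..N. det (x i) powr w i)"
    using assms(1)
    by (simp add: det mean powr_def exp_sum[symmetric] sum.distrib distrib_left)
qed

end
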